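(* Let $\rho\in[0,1]$ and $\mathcal{B}=\{w\in\mathbb{R}^k:\|w-\mathbf d\|_2^2\le r\}$ for some $r>0$ and $\mathbf d\in\mathbb{R}^k$. Let (P-QDR), $\widetilde X$, $F$, $E$, $H$, $G$ and $K$ be as defined in the context. Then the problem (P-QDR) and the unconstrained convex composite problem have the same optimal value: $$\min\,(\text{P-QDR})\;=\;\min_{\widetilde x\in\widetilde X}\Big\{F(\widetilde x)+E(\widetilde x)+H(\widetilde x)+G(K\widetilde x)\Big\}.$$
   Context: Notation: $\mathbb{S}^n$ is the space of real symmetric $n\times n$ matrices, $\mathbb{S}^n_+$ the cone of positive semidefinite ones, $\iota_A$ the indicator function of a set $A$ (equal to $0$ on $A$ and $+\infty$ off $A$), $I_k$ the $k\times k$ identity matrix, $\overline{\mathbb{R}}=\mathbb{R}\cup\{+\infty\}$. The symbol $\min$ of a problem denotes its optimal value. A real polynomial $g$ on $\mathbb{R}^d$ is SOS-convex if its Hessian can be written as $H(x)=P(x)^\top P(x)$ for some $\nu\times d$ polynomial matrix $P(x)$, $\nu\in\mathbb{N}$. Data: $f:\mathbb{R}^d\to\overline{\mathbb{R}}$ is a proper, convex, lower semicontinuous function (assumed proximable, i.e. its proximal operator is efficiently computable); $\mathcal{C}\subseteq\mathbb{R}^d$ is a closed convex set (with efficiently computable projection); $g_1,\dots,g_s$ are SOS-convex polynomials on $\mathbb{R}^d$ and $\mathcal{D}=\{x\in\mathbb{R}^d: g_j(x)\le 0,\ j=1,\dots,s\}$; for $i=1,\dots,m$ and $\ell=0,\dots,k$,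 $a_i^{(\ell)}\in\mathbb{R}^d$, $b_i^{(\ell)}\in\mathbb{R}$, and $c_i=(c_i^{(1)},\dots,c_i^{(q)})\in\mathbb{R}^q$. Put $A_i=[\,a_i^{(1)}\ \cdots\ a_i^{(k)}\,]\in\mathbb{R}^{d\times k}$ and $\mathbf b_i=(b_i^{(1)},\dots,b_i^{(k)})^\top\in\mathbb{R}^k$. Problem (P-QDR) (obtained from a two-stage adjustable robust problem by a quadratic decision rule with parameter $\rho$): minimise, over $\widehat x=(x,y_0,U,\Theta)\in\mathbb{R}^d\times\mathbb{R}^q\times\mathbb{R}^{q\times k}\times\prod_{p=1}^q\mathbb{S}^k$ with $\Theta=(\Theta_1,\dots,\Theta_q)$, the objective $$f(x)+\iota_{\mathcal{C}}(x)+\iota_{\mathcal{D}}(x)$$ subject to $$w^\top P_i(\widehat x)w+2q_i(\widehat x)^\top w+\beta_i(\widehat x)\ge 0\quad\text{for all } w\in\mathcal{B},\ i=1,\dots,m,$$ where $P_i(\widehat x)=-(1-\rho)\sum_{p=1}^q c_i^{(p)}\Theta_p$, $q_i(\widehat x)=-\tfrac12\big(\rho U^\top c_i+A_i^\top x-\mathbf b_i\big)$ and $\beta_i(\widehat x)=-(a_i^{(0)})^\top x+b_i^{(0)}-\rho c_i^\top y_0$. Composite problem: $\widetilde X=\mathbb{R}^d\times\mathbb{R}^q\times\mathbb{R}^{q\times k}\times\prod_{p=1}^q\mathbb{S}^k\times\mathbb{R}^m$, $\widetilde Y=\prod_{i=1}^m\mathbb{S}^{k+1}$. For $\widetilde x=(x,y_0,U,\Theta,\lambda)\in\widetilde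 X$, $\lambda=(\lambda_1,\dots,\lambda_m)$, and $\widetilde y=(\Psi_1,\dots,\Psi_m)\in\widetilde Y$, $$F(\widetilde x)=f(x)+\sum_{i=1}^m\iota_{\mathbb{R}_+}(\lambda_i),\quad E(\widetilde x)=\iota_{\mathcal{C}}(x),\quad H(\widetilde x)=\iota_{\mathcal{D}}(x),\quad G(\widetilde y)=\sum_{i=1}^m\iota_{B_i+\mathbb{S}^{k+1}_+}(\Psi_i),$$ where $B_i=\begin{bmatrix}0&-\tfrac12\mathbf b_i\\-\tfrac12\mathbf b_i^\top&-b_i^{(0)}\end{bmatrix}\in\mathbb{S}^{k+1}$. The linear map $K:\widetilde X\to\widetilde Y$ is $K\widetilde x=(\Psi_1(\widetilde x),\dots,\Psi_m(\widetilde x))$ with $$\Psi_i(\widetilde x)=\begin{bmatrix}\lambda_iI_k-(1-\rho)\sum_{p=1}^qc_i^{(p)}\Theta_p&-\lambda_i\mathbf d-\tfrac12(\rho U^\top c_i+A_i^\top x)\\ \big(-\lambda_i\mathbf d-\tfrac12(\rho U^\top c_i+A_i^\top x)\big)^\top&\lambda_i(\|\mathbf d\|_2^2-r)-(a_i^{(0)})^\top x-\rho c_i^\top y_0\end{bmatrix}.$$ *)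

theory Defs
  imports "HOL-Analysis.Analysis"
begin

section \<open>Extended-valued functions, symmetric matrices, SOS-convexity\<close>

definition iota :: "'a set \<Rightarrow> 'a \<Rightarrow> ereal" where
  "iota A x = (if x \<in> A then 0 else \<infinity>)"

definition proper_fun :: "('a \<Rightarrow> ereal) \<Rightarrow> bool" where
  "proper_fun f \<longleftrightarrow> (\<forall>x. f x \<noteq> -\<infinity>) \<and> (\<exists>x. f x \<noteq> \<infinity>)"

text \<open>Meant for functions that never take the value \<open>-\<infinity>\<close>, so that no sum of opposite
  infinities occurs.\<close>
definition convex_fun :: "('a::real_vector \<Rightarrow> ereal) \<Rightarrow> bool" where
  "convex_fun f \<longleftrightarrow>
     (\<forall>x y. \<forall>t\<in>{0<..<1::real}.
        f ((1 - t) *\<^sub>R x + t *\<^sub>R y) \<le> ereal (1 - t) * f x + ereal t * f y)"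

definition lsc_fun :: "('a::topological_space \<Rightarrow> ereal) \<Rightarrow> bool" where
  "lsc_fun f \<longleftrightarrow> (\<forall>x. f x \<le> Liminf (at x) f)"

definition sym_mat :: "(real^'n^'n) set" where
  "sym_mat = {M. transpose M = M}"

definition psd_cone :: "(real^'n^'n) set" where
  "psd_cone = {M \<in> sym_mat. \<forall>v. 0 \<le> v \<bullet> (M *v v)}"

definition partial_deriv :: "'n \<Rightarrow> (real^'n \<Rightarrow> real) \<Rightarrow> real^'n \<Rightarrow> real" where
  "partial_deriv i g x = frechet_derivative g (at x) (axis i 1)"

definition hessian :: "(real^'n \<Rightarrow> real) \<Rightarrow> real^'n \<Rightarrow> real^'n^'n" where
  "hessian g x = (\<chi> i j. partial_deriv i (partial_deriv j g) x)"

text \<open>The polynomial matrix \<open>P\<close> has rows indexed by \<open>l < \<nu>\<close> and columns indexed by \<open>'n\<close>; the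
  right-hand side below is \<open>P(x)\<^sup>T P(x)\<close>.\<close>
definition sos_convex :: "(real^'n \<Rightarrow> real) \<Rightarrow> bool" where
  "sos_convex g \<longleftrightarrow> real_polynomial_function g \<and>
     (\<exists>(\<nu>::nat) (P :: nat \<Rightarrow> 'n \<Rightarrow> real^'n \<Rightarrow> real).
        (\<forall>l<\<nu>. \<forall>j. real_polynomial_function (P l j)) \<and>
        (\<forall>x. hessian g x = (\<chi> i j. \<Sum>l<\<nu>. P l i x * P l j x)))"

section \<open>The problem (P-QDR)\<close>

text \<open>The dimensions \<open>d, q, k\<close> and the number \<open>m\<close> of robust constraints are the cardinalities of
  the index types \<open>'d, 'q, 'k, 'm\<close>. The data \<open>a\<^sub>i\<^sup>(\<^sup>l\<^sup>)\<close> and \<open>b\<^sub>i\<^sup>(\<^sup>l\<^sup>)\<close> are split into the part for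
  \<open>l = 0\<close> (\<open>a0 i\<close>, \<open>b0 i\<close>) and the part for \<open>l = 1, \<dots>, k\<close> (\<open>a i l\<close>, \<open>b i $ l\<close>).\<close>

definition level_set :: "nat \<Rightarrow> (nat \<Rightarrow> 'v \<Rightarrow> real) \<Rightarrow> 'v set" where
  "level_set s g = {x. \<forall>j\<in>{1..s}. g j x \<le> 0}"

definition A_mat :: "('m \<Rightarrow> 'k \<Rightarrow> real^'d) \<Rightarrow> 'm \<Rightarrow> real^'k^'d" where
  "A_mat a i = (\<chi> r l. a i l $ r)"

type_synonym ('d, 'q, 'k) qdr_var =
  "(real^'d) \<times> (real^'q) \<times> (real^'k^'q) \<times> (real^'k^'k^'q)"

definition X_hat :: "('d::finite, 'q::finite, 'k::finite) qdr_var set" where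
  "X_hat = {(x, y0, U, \<Theta>). \<forall>p. \<Theta> $ p \<in> sym_mat}"

fun P_qdr :: "real \<Rightarrow> ('m \<Rightarrow> real^'q) \<Rightarrow> 'm \<Rightarrow>
    ('d::finite, 'q::finite, 'k::finite) qdr_var \<Rightarrow> real^'k^'k" where
  "P_qdr \<rho> c i (x, y0, U, \<Theta>) = - ((1 - \<rho>) *\<^sub>R (\<Sum>p\<in>UNIV. (c i $ p) *\<^sub>R (\<Theta> $ p)))"

fun q_qdr :: "real \<Rightarrow> ('m \<Rightarrow> 'k \<Rightarrow> real^'d) \<Rightarrow> ('m \<Rightarrow> real^'k) \<Rightarrow> ('m \<Rightarrow> real^'q) \<Rightarrow> 'm \<Rightarrow>
    ('d::finite, 'q::finite, 'k::finite) qdr_var \<Rightarrow> real^'k" where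
  "q_qdr \<rho> a b c i (x, y0, U, \<Theta>) =
     - ((1/2) *\<^sub>R (\<rho> *\<^sub>R (transpose U *v c i) + transpose (A_mat a i) *v x - b i))"

fun beta_qdr :: "real \<Rightarrow> ('m \<Rightarrow> real^'d) \<Rightarrow> ('m \<Rightarrow> real) \<Rightarrow> ('m \<Rightarrow> real^'q) \<Rightarrow> 'm \<Rightarrow>
    ('d::finite, 'q::finite, 'k::finite) qdr_var \<Rightarrow> real" where
  "beta_qdr \<rho> a0 b0 c i (x, y0, U, \<Theta>) = - (a0 i \<bullet> x) + b0 i - \<rho> * (c i \<bullet> y0)"

definition qdr_feasible :: "(real^'k) set \<Rightarrow> real \<Rightarrow> ('m \<Rightarrow> real^'d) \<Rightarrow> ('m \<Rightarrow> 'k \<Rightarrow> real^'d) \<Rightarrow>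
    ('m \<Rightarrow> real) \<Rightarrow> ('m \<Rightarrow> real^'k) \<Rightarrow> ('m \<Rightarrow> real^'q) \<Rightarrow>
    ('d::finite, 'q::finite, 'k::finite) qdr_var set" where
  "qdr_feasible \<B> \<rho> a0 a b0 b c =
     {z \<in> X_hat. \<forall>i. \<forall>w\<in>\<B>.
        w \<bullet> (P_qdr \<rho> c i z *v w) + 2 * (q_qdr \<rho> a b c i z \<bullet> w) + beta_qdr \<rho> a0 b0 c i z \<ge> 0}"

fun qdr_objective :: "(real^'d \<Rightarrow> ereal) \<Rightarrow> (real^'d) set \<Rightarrow> (real^'d) set \<Rightarrow>
    ('d::finite, 'q::finite, 'k::finite) qdr_var \<Rightarrow> ereal" where
  "qdr_objective f \<C> \<D> (x, y0, U, \<Theta>) = f x + iota \<C> x + iota \<D> x"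

definition qdr_value where
  "qdr_value f \<C> \<D> \<B> \<rho> a0 a b0 b c =
     (INF z \<in> qdr_feasible \<B> \<rho> a0 a b0 b c. qdr_objective f \<C> \<D> z)"

section \<open>The composite problem\<close>

type_synonym ('d, 'q, 'k, 'm) comp_var =
  "(real^'d) \<times> (real^'q) \<times> (real^'k^'q) \<times> (real^'k^'k^'q) \<times> (real^'m)"

text \<open>Square matrices of size \<open>k + 1\<close> are indexed by the sum type \<open>'k + 1\<close>.\<close>
type_synonym ('k, 'm) comp_img = "real^('k + 1)^('k + 1)^'m"

definition X_tilde :: "('d::finite, 'q::finite, 'k::finite, 'm::finite) comp_var set" where
  "X_tilde = {(x, y0, U, \<Theta>, lam). \<forall>p. \<Theta> $ p \<in> sym_mat}"

definition Y_tilde :: "('k::finite, 'm::finite) comp_img set" where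
  "Y_tilde = {\<Psi>. \<forall>i. \<Psi> $ i \<in> sym_mat}"

text \<open>\<open>bordered M v t\<close> is the block matrix with rows \<open>[M, v]\<close> and \<open>[v\<^sup>T, t]\<close>.\<close>
definition bordered :: "real^'k^'k \<Rightarrow> real^'k \<Rightarrow> real \<Rightarrow> real^('k + 1)^('k + 1)" where
  "bordered M v t =
     (\<chi> r s. case r of
        Inl r' \<Rightarrow> (case s of Inl s' \<Rightarrow> M $ r' $ s' | Inr _ \<Rightarrow> v $ r')
      | Inr _ \<Rightarrow> (case s of Inl s' \<Rightarrow> v $ s' | Inr _ \<Rightarrow> t))"

definition B_mat :: "('m \<Rightarrow> real) \<Rightarrow> ('m \<Rightarrow> real^'k) \<Rightarrow> 'm \<Rightarrow> real^('k + 1)^('k + 1)" where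
  "B_mat b0 b i = bordered 0 (- ((1/2) *\<^sub>R b i)) (- b0 i)"

fun F_comp :: "(real^'d \<Rightarrow> ereal) \<Rightarrow>
    ('d::finite, 'q::finite, 'k::finite, 'm::finite) comp_var \<Rightarrow> ereal" where
  "F_comp f (x, y0, U, \<Theta>, lam) = f x + (\<Sum>i\<in>UNIV. iota {0..} (lam $ i))"

fun E_comp :: "(real^'d) set \<Rightarrow>
    ('d::finite, 'q::finite, 'k::finite, 'm::finite) comp_var \<Rightarrow> ereal" where
  "E_comp \<C> (x, y0, U, \<Theta>, lam) = iota \<C> x"

fun H_comp :: "(real^'d) set \<Rightarrow>
    ('d::finite, 'q::finite, 'k::finite, 'm::finite) comp_var \<Rightarrow> ereal" where
  "H_comp \<D> (x, y0, U, \<Theta>, lam) = iota \<D> x"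

definition G_comp :: "('m \<Rightarrow> real) \<Rightarrow> ('m \<Rightarrow> real^'k) \<Rightarrow>
    ('k::finite, 'm::finite) comp_img \<Rightarrow> ereal" where
  "G_comp b0 b \<Psi> = (\<Sum>i\<in>UNIV. iota ((\<lambda>M. B_mat b0 b i + M) ` psd_cone) (\<Psi> $ i))"

fun K_comp :: "real^'k \<Rightarrow> real \<Rightarrow> real \<Rightarrow> ('m \<Rightarrow> real^'d) \<Rightarrow> ('m \<Rightarrow> 'k \<Rightarrow> real^'d) \<Rightarrow>
    ('m \<Rightarrow> real^'q) \<Rightarrow>
    ('d::finite, 'q::finite, 'k::finite, 'm::finite) comp_var \<Rightarrow> ('k, 'm) comp_img" where
  "K_comp dd r \<rho> a0 a c (x, y0, U, \<Theta>, lam) =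
     (\<chi> i. bordered
        ((lam $ i) *\<^sub>R mat 1 - (1 - \<rho>) *\<^sub>R (\<Sum>p\<in>UNIV. (c i $ p) *\<^sub>R (\<Theta> $ p)))
        (- ((lam $ i) *\<^sub>R dd)
           - (1/2) *\<^sub>R (\<rho> *\<^sub>R (transpose U *v c i) + transpose (A_mat a i) *v x))
        ((lam $ i) * ((norm dd)\<^sup>2 - r) - a0 i \<bullet> x - \<rho> * (c i \<bullet> y0)))"

text \<open>\<open>B_mat b0 b i\<close> is symmetric, and \<open>K_comp\<close> maps \<open>X_tilde\<close> into \<open>Y_tilde\<close>.\<close>

lemma bordered_sym_mat: "M \<in> sym_mat \<Longrightarrow> bordered M v t \<in> sym_mat"
  by (auto simp: sym_mat_def bordered_def transpose_def vec_eq_iff split: sum.split)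

lemma B_mat_sym_mat: "B_mat b0 b i \<in> sym_mat"
  unfolding B_mat_def
  by (rule bordered_sym_mat) (simp add: sym_mat_def transpose_def vec_eq_iff)

lemma K_comp_Y_tilde: "z \<in> X_tilde \<Longrightarrow> K_comp dd r \<rho> a0 a c z \<in> Y_tilde"
  by (cases z)
    (auto simp: X_tilde_def Y_tilde_def intro!: bordered_sym_mat,
     auto simp: sym_mat_def transpose_def vec_eq_iff mat_def)

end

theory Submission
  imports Defs
begin

text \<open>
  Once the multiplier \<open>\<lambda>\<^sub>i\<close> is fixed, membership of \<open>\<Psi>\<^sub>i\<close> in \<open>B\<^sub>i + psd_cone\<close> says that the bordered
  matrix with blocks \<open>P\<^sub>i + \<lambda>\<^sub>i I\<close>, \<open>q\<^sub>i - \<lambda>\<^sub>i d\<close> and \<open>\<beta>\<^sub>i + \<lambda>\<^sub>i (\<parallel>d\<parallel>\<^sup>2 - r)\<close> is positive semidefinite. After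
  dehomogenisation (\<open>bordered_psd_iff\<close>) this means that
  \<open>w\<^sup>T P\<^sub>i w + 2 q\<^sub>i\<^sup>T w + \<beta>\<^sub>i + \<lambda>\<^sub>i (\<parallel>w - d\<parallel>\<^sup>2 - r) \<ge> 0\<close> for every \<open>w\<close>. So the two problems agree as soon as the
  robust constraint over the ball is equivalent to the existence of such a \<open>\<lambda>\<^sub>i \<ge> 0\<close>, which is the S-lemma
  for a ball (\<open>S_lemma_ball\<close>).

  The quadratic need not be convex, so convex duality does not give the S-lemma directly.
  The proof here is that of the trust-region subproblem: a minimiser \<open>w\<close> of the quadratic over the
  compact ball has a Lagrange multiplier \<open>\<lambda>\<close> (first-order condition), and because the whole sphere
  competes with \<open>w\<close>, \<open>P + \<lambda> I\<close> is positive semidefinite in all directions, not only in the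
  tangential ones. The Lagrangian is then a convex quadratic with critical point \<open>w\<close>,
  and its minimum is the minimum of the original quadratic over the ball.

  Given this, the objective of the composite problem is the objective of (P-QDR) wherever the
  indicators of \<open>\<lambda>\<^sub>i \<ge> 0\<close> and of the shifted semidefinite cones vanish, and \<open>\<infinity>\<close> elsewhere; forgetting \<open>\<lambda>\<close> maps
  the points where they vanish onto the feasible points of (P-QDR).
\<close>

section \<open>Quadratic functions and their minima over a ball\<close>

lemma nonneg_at_0_if_eventually_nonneg:
  fixes a b c :: real
  assumes "\<forall>\<^sub>F t in at_right 0. 0 \<le> a + b * t + c * t\<^sup>2"
  shows "0 \<le> a"
proof -
  have "((\<lambda>t. a + b * t + c * t\<^sup>2) \<longlongrightarrow> a + b * 0 + c * 0\<^sup>2) (at_right 0)"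
    by (intro tendsto_intros)
  from tendsto_lowerbound[OF this assms] show ?thesis
    by simp
qed

definition quad :: "('a::real_inner \<Rightarrow> 'a) \<Rightarrow> 'a \<Rightarrow> real \<Rightarrow> 'a \<Rightarrow> real" where
  "quad T q \<beta> w = w \<bullet> T w + 2 * (q \<bullet> w) + \<beta>"

lemma quad_expand:
  assumes "linear T" and "\<And>x y. x \<bullet> T y = T x \<bullet> y"
  shows "quad T q \<beta> (w + t *\<^sub>R v) = quad T q \<beta> w + 2 * ((T w + q) \<bullet> v) * t + (v \<bullet> T v) * t\<^sup>2"
proof -
  have "w \<bullet> T v = T w \<bullet> v" "v \<bullet> T w = T w \<bullet> v"
    using assms(2) by (auto simp: inner_commute)
  then show ?thesis
    by (simp add: quad_def linear_add[OF assms(1)] linear_cmul[OF assms(1)] inner_add_left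
        inner_add_right algebra_simps power2_eq_square)
qed

lemma norm_add_scaleR_squared:
  fixes u v :: "'a::real_inner"
  shows "(norm (u + t *\<^sub>R v))\<^sup>2 = (norm u)\<^sup>2 + 2 * (u \<bullet> v) * t + (norm v)\<^sup>2 * t\<^sup>2"
  unfolding power2_norm_eq_inner
  by (simp add: inner_add_left inner_add_right inner_commute algebra_simps power2_eq_square)

text \<open>A direction \<open>v\<close> that keeps \<open>w\<close> inside the ball for small steps cannot decrease the quadratic to
  first order, nor to second order when the first-order term vanishes.\<close>
lemma quad_min_along_feasible_direction:
  fixes v w d :: "'a::real_inner"
  assumes T: "linear T" "\<And>x y. x \<bullet> T y = T x \<bullet> y"
    and min: "\<And>w'. (norm (w' - d))\<^sup>2 \<le> r \<Longrightarrow> quad T q \<beta> w \<le> quad T q \<beta> w'"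
    and inside: "\<forall>\<^sub>F t in at_right 0. (norm (w - d + t *\<^sub>R v))\<^sup>2 \<le> r"
  shows "0 \<le> (T w + q) \<bullet> v"
    and "(T w + q) \<bullet> v = 0 \<Longrightarrow> 0 \<le> v \<bullet> T v"
proof -
  have ev: "\<forall>\<^sub>F t in at_right 0. 0 < t \<and> 0 \<le> 2 * ((T w + q) \<bullet> v) * t + (v \<bullet> T v) * t\<^sup>2"
    using inside eventually_at_right_less[of 0]
  proof eventually_elim
    case (elim t)
    have "quad T q \<beta> w \<le> quad T q \<beta> (w + t *\<^sub>R v)"
      using elim by (intro min) (simp add: algebra_simps)
    then show ?case
      using elim by (simp add: quad_expand[OF T])
  qed
  have "\<forall>\<^sub>F t in at_right 0. 0 \<le> 2 * ((T w + q) \<bullet> v) + (v \<bullet> T v) * t + 0 * t\<^sup>2"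
    using ev
  proof eventually_elim
    case (elim t)
    then have "0 \<le> t * (2 * ((T w + q) \<bullet> v) + (v \<bullet> T v) * t)"
      by (simp add: algebra_simps power2_eq_square)
    with elim show ?case
      by (simp add: zero_le_mult_iff)
  qed
  from nonneg_at_0_if_eventually_nonneg[OF this] show "0 \<le> (T w + q) \<bullet> v"
    by simp
  assume "(T w + q) \<bullet> v = 0"
  then have "0 \<le> v \<bullet> T v + 0 * t + 0 * t\<^sup>2"
    if "0 < t \<and> 0 \<le> 2 * ((T w + q) \<bullet> v) * t + (v \<bullet> T v) * t\<^sup>2" for t
    using that by (auto simp: zero_le_mult_iff)
  then have "\<forall>\<^sub>F t in at_right 0. 0 \<le> v \<bullet> T v + 0 * t + 0 * t\<^sup>2"
    by (rule eventually_mono[OF ev])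
  from nonneg_at_0_if_eventually_nonneg[OF this] show "0 \<le> v \<bullet> T v" .
qed

text \<open>At an interior minimiser every direction is feasible together with its opposite, so the
  gradient vanishes and the form is positive semidefinite.\<close>
lemma quad_min_interior:
  fixes w d :: "'a::real_inner"
  assumes T: "linear T" "\<And>x y. x \<bullet> T y = T x \<bullet> y"
    and min: "\<And>w'. (norm (w' - d))\<^sup>2 \<le> r \<Longrightarrow> quad T q \<beta> w \<le> quad T q \<beta> w'"
    and interior: "(norm (w - d))\<^sup>2 < r"
  shows "T w + q = 0" and "0 \<le> v \<bullet> T v"
proof -
  have inside: "\<forall>\<^sub>F t in at_right 0. (norm (w - d + t *\<^sub>R u))\<^sup>2 \<le> r" for u
  proof -
    have "((\<lambda>t. (norm (w - d + t *\<^sub>R u))\<^sup>2) \<longlongrightarrow> (norm (w - d + 0 *\<^sub>R u))\<^sup>2) (at_right 0)"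
      by (intro tendsto_intros)
    then have "\<forall>\<^sub>F t in at_right 0. (norm (w - d + t *\<^sub>R u))\<^sup>2 < r"
      using interior by (intro order_tendstoD(2)) auto
    then show ?thesis
      by (rule eventually_mono) simp
  qed
  have "0 \<le> (T w + q) \<bullet> (- (T w + q))"
    by (rule quad_min_along_feasible_direction(1)[OF T min inside])
  then have "(T w + q) \<bullet> (T w + q) \<le> 0"
    unfolding inner_minus_right by linarith
  then show grad: "T w + q = 0"
    by (metis inner_eq_zero_iff inner_ge_zero order_antisym)
  show "0 \<le> v \<bullet> T v"
    by (rule quad_min_along_feasible_direction(2)[OF T min inside]) (simp_all add: grad)
qed

text \<open>At a minimiser on the sphere the gradient makes a nonnegative inner product with every inward
  direction; projecting the negative gradient onto the tangent space and tilting it slightly inwards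
  shows that the gradient has no tangential part.\<close>
lemma quad_min_boundary_multiplier:
  fixes w d :: "'a::real_inner"
  assumes T: "linear T" "\<And>x y. x \<bullet> T y = T x \<bullet> y"
    and min: "\<And>w'. (norm (w' - d))\<^sup>2 \<le> r \<Longrightarrow> quad T q \<beta> w \<le> quad T q \<beta> w'"
    and boundary: "(norm (w - d))\<^sup>2 = r" and "r > 0"
  obtains \<mu> where "0 \<le> \<mu>" and "T w + q = - (\<mu> *\<^sub>R (w - d))"
proof -
  define u where "u = w - d"
  define g where "g = T w + q"
  have uu: "u \<bullet> u = r"
    using boundary by (simp add: u_def power2_norm_eq_inner)
  have inward: "0 \<le> g \<bullet> v" if "u \<bullet> v < 0" for v
    unfolding g_def
  proof (rule quad_min_along_feasible_direction(1)[OF T min])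
    have "((\<lambda>t. 2 * (u \<bullet> v) + (norm v)\<^sup>2 * t) \<longlongrightarrow> 2 * (u \<bullet> v) + (norm v)\<^sup>2 * 0) (at_right 0)"
      by (intro tendsto_intros)
    then have "\<forall>\<^sub>F t in at_right 0. 2 * (u \<bullet> v) + (norm v)\<^sup>2 * t < 0"
      by (rule order_tendstoD(2)) (use that in simp)
    then show "\<forall>\<^sub>F t in at_right 0. (norm (w - d + t *\<^sub>R v))\<^sup>2 \<le> r"
      using eventually_at_right_less[of 0]
    proof eventually_elim
      case (elim t)
      then have "t * (2 * (u \<bullet> v) + (norm v)\<^sup>2 * t) \<le> 0"
        by (simp add: mult_le_0_iff)
      then show ?case
        using boundary
        by (simp add: norm_add_scaleR_squared flip: u_def)
          (simp add: algebra_simps power2_eq_square)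
    qed
  qed
  define \<mu> where "\<mu> = - (g \<bullet> u) / r"
  have gu: "g \<bullet> u = - \<mu> * r"
    using \<open>r > 0\<close> by (simp add: \<mu>_def)
  have "0 \<le> g \<bullet> (- u)"
    by (rule inward) (use uu \<open>r > 0\<close> in simp)
  then have "0 \<le> \<mu>"
    using \<open>r > 0\<close> by (simp add: \<mu>_def divide_le_0_iff)
  define h where "h = g + \<mu> *\<^sub>R u"
  have uh: "u \<bullet> h = 0"
    by (simp add: h_def inner_add_right uu gu inner_commute[of u g])
  have gh: "g \<bullet> h = h \<bullet> h"
  proof -
    have "g = h - \<mu> *\<^sub>R u"
      by (simp add: h_def)
    then show ?thesis
      by (simp add: inner_diff_left uh)
  qed
  have "\<forall>\<^sub>F t in at_right 0. 0 \<le> - (h \<bullet> h) + (- (g \<bullet> u)) * t + 0 * t\<^sup>2"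
    using eventually_at_right_less[of 0]
  proof eventually_elim
    case (elim t)
    have "0 \<le> g \<bullet> (- h - t *\<^sub>R u)"
      by (rule inward) (use elim uu \<open>r > 0\<close> in \<open>simp add: inner_diff_right uh\<close>)
    then show ?case
      by (simp add: inner_diff_right gh algebra_simps)
  qed
  from nonneg_at_0_if_eventually_nonneg[OF this] have "h \<bullet> h = 0"
    using inner_ge_zero[of h] by simp
  then have "g = - (\<mu> *\<^sub>R u)"
    by (simp add: h_def eq_neg_iff_add_eq_0)
  with \<open>0 \<le> \<mu>\<close> show ?thesis
    by (intro that[of \<mu>]) (simp_all add: g_def u_def)
qed

text \<open>The line through \<open>w\<close> in a direction \<open>v\<close> that is not tangential meets the sphere in a second point.
  There the constraint is active as well, so the comparison with \<open>w\<close> is a comparison of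
  the Lagrangian, whose first-order term vanishes. Tangential directions are limits of
  such directions.\<close>
lemma quad_min_boundary_curvature:
  fixes v w d :: "'a::real_inner"
  assumes T: "linear T" "\<And>x y. x \<bullet> T y = T x \<bullet> y"
    and min: "\<And>w'. (norm (w' - d))\<^sup>2 \<le> r \<Longrightarrow> quad T q \<beta> w \<le> quad T q \<beta> w'"
    and boundary: "(norm (w - d))\<^sup>2 = r" and "r > 0"
    and grad: "T w + q = - (\<mu> *\<^sub>R (w - d))"
  shows "0 \<le> v \<bullet> T v + \<mu> * (v \<bullet> v)"
proof -
  define u where "u = w - d"
  have uu: "u \<bullet> u = r"
    using boundary by (simp add: u_def power2_norm_eq_inner)
  have transversal: "0 \<le> v \<bullet> T v + \<mu> * (v \<bullet> v)" if "u \<bullet> v \<noteq> 0" for v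
  proof -
    have "v \<noteq> 0"
      using that by auto
    then have "v \<bullet> v > 0"
      by simp
    \<comment> \<open>the step to the second intersection point of the line with the sphere\<close>
    define t where "t = - 2 * (u \<bullet> v) / (v \<bullet> v)"
    have "t \<noteq> 0"
      using that \<open>v \<bullet> v > 0\<close> by (simp add: t_def)
    have t: "2 * (u \<bullet> v) = - ((v \<bullet> v) * t)"
      using \<open>v \<noteq> 0\<close> by (simp add: t_def)
    have "(norm (u + t *\<^sub>R v))\<^sup>2 = r"
      unfolding norm_add_scaleR_squared t unfolding power2_norm_eq_inner uu
      by (simp add: power2_eq_square)
    then have "quad T q \<beta> w \<le> quad T q \<beta> (w + t *\<^sub>R v)"
      by (intro min) (simp add: u_def algebra_simps)
    then have "0 \<le> 2 * ((T w + q) \<bullet> v) * t + (v \<bullet> T v) * t\<^sup>2"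
      by (simp add: quad_expand[OF T])
    also have "2 * ((T w + q) \<bullet> v) * t = - \<mu> * (2 * (u \<bullet> v)) * t"
      by (simp add: grad u_def)
    also have "\<dots> + (v \<bullet> T v) * t\<^sup>2 = (v \<bullet> T v + \<mu> * (v \<bullet> v)) * t\<^sup>2"
      unfolding t by (simp add: algebra_simps power2_eq_square)
    finally show ?thesis
      using \<open>t \<noteq> 0\<close> by (simp add: zero_le_mult_iff)
  qed
  show ?thesis
  proof (cases "u \<bullet> v = 0")
    case True
    have "\<forall>\<^sub>F t in at_right 0. 0 \<le> (v \<bullet> T v + \<mu> * (v \<bullet> v)) + 2 * (T v \<bullet> u) * t
        + (u \<bullet> T u + \<mu> * (u \<bullet> u)) * t\<^sup>2"
      using eventually_at_right_less[of 0]
    proof eventually_elim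
      case (elim t)
      let ?v = "v + t *\<^sub>R u"
      have "0 \<le> ?v \<bullet> T ?v + \<mu> * (?v \<bullet> ?v)"
        by (rule transversal) (use elim uu \<open>r > 0\<close> True in \<open>simp add: inner_add_right\<close>)
      moreover have "?v \<bullet> T ?v = v \<bullet> T v + 2 * (T v \<bullet> u) * t + (u \<bullet> T u) * t\<^sup>2"
        using quad_expand[OF T, of 0 0 v t u] by (simp add: quad_def)
      moreover have "?v \<bullet> ?v = v \<bullet> v + (u \<bullet> u) * t\<^sup>2"
        using norm_add_scaleR_squared[of v t u] True
        by (simp add: power2_norm_eq_inner inner_commute)
      ultimately show ?case
        by (simp only: distrib_left distrib_right mult.assoc ac_simps)
    qed
    then show ?thesis
      by (rule nonneg_at_0_if_eventually_nonneg)
  qed (rule transversal)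
qed

text \<open>With the multiplier of a minimiser \<open>w\<close> over the ball, the Lagrangian is a convex quadratic
  with critical point \<open>w\<close>, and complementary slackness makes its value there the minimum
  over the ball.\<close>
lemma S_lemma_ball:
  fixes T :: "'a::euclidean_space \<Rightarrow> 'a"
  assumes T: "linear T" "\<And>x y. x \<bullet> T y = T x \<bullet> y" and "r > 0"
  shows "(\<forall>w. (norm (w - d))\<^sup>2 \<le> r \<longrightarrow> 0 \<le> quad T q \<beta> w) \<longleftrightarrow>
    (\<exists>\<mu>\<ge>0. \<forall>w. 0 \<le> quad T q \<beta> w + \<mu> * ((norm (w - d))\<^sup>2 - r))"
proof
  assume "\<exists>\<mu>\<ge>0. \<forall>w. 0 \<le> quad T q \<beta> w + \<mu> * ((norm (w - d))\<^sup>2 - r)"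
  then obtain \<mu> where "\<mu> \<ge> 0" and *: "\<And>w. 0 \<le> quad T q \<beta> w + \<mu> * ((norm (w - d))\<^sup>2 - r)"
    by blast
  show "\<forall>w. (norm (w - d))\<^sup>2 \<le> r \<longrightarrow> 0 \<le> quad T q \<beta> w"
  proof (intro allI impI)
    fix w assume "(norm (w - d))\<^sup>2 \<le> r"
    with \<open>\<mu> \<ge> 0\<close> have "\<mu> * ((norm (w - d))\<^sup>2 - r) \<le> 0"
      by (simp add: mult_le_0_iff)
    with *[of w] show "0 \<le> quad T q \<beta> w"
      by linarith
  qed
next
  assume nonneg: "\<forall>w. (norm (w - d))\<^sup>2 \<le> r \<longrightarrow> 0 \<le> quad T q \<beta> w"
  have ball: "(norm (w - d))\<^sup>2 \<le> r \<longleftrightarrow> w \<in> cball d (sqrt r)" for w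
    by (subst real_sqrt_le_iff[symmetric])
      (simp add: dist_norm norm_minus_commute del: real_sqrt_le_iff)
  have "continuous_on (cball d (sqrt r)) (quad T q \<beta>)"
    unfolding quad_def
    by (intro continuous_intros linear_continuous_on linear_conv_bounded_linear[THEN iffD1] T)
  then obtain w where w: "(norm (w - d))\<^sup>2 \<le> r"
    and min: "\<And>w'. (norm (w' - d))\<^sup>2 \<le> r \<Longrightarrow> quad T q \<beta> w \<le> quad T q \<beta> w'"
    using continuous_attains_inf[of "cball d (sqrt r)" "quad T q \<beta>"] \<open>r > 0\<close>
    unfolding ball by auto
  obtain \<mu> where "0 \<le> \<mu>" and slack: "\<mu> * ((norm (w - d))\<^sup>2 - r) = 0"
    and grad: "T w + q = - (\<mu> *\<^sub>R (w - d))"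
    and psd: "\<And>v. 0 \<le> v \<bullet> T v + \<mu> * (v \<bullet> v)"
  proof (cases "(norm (w - d))\<^sup>2 = r")
    case True
    obtain \<mu> where "0 \<le> \<mu>" "T w + q = - (\<mu> *\<^sub>R (w - d))"
      using quad_min_boundary_multiplier[OF T min True \<open>r > 0\<close>] by blast
    with True show thesis
      using quad_min_boundary_curvature[OF T min True \<open>r > 0\<close>] by (intro that) auto
  next
    case False
    with w have "(norm (w - d))\<^sup>2 < r"
      by simp
    from quad_min_interior[OF T min this] show thesis
      by (intro that[of 0]) auto
  qed
  have "0 \<le> quad T q \<beta> w' + \<mu> * ((norm (w' - d))\<^sup>2 - r)" for w'
  proof -
    define v where "v = w' - w"
    have w': "w' = w + 1 *\<^sub>R v" and wd: "w' - d = (w - d) + 1 *\<^sub>R v"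
      by (simp_all add: v_def)
    have "quad T q \<beta> w' + \<mu> * ((norm (w' - d))\<^sup>2 - r) =
        quad T q \<beta> w + \<mu> * ((norm (w - d))\<^sup>2 - r) + (v \<bullet> T v + \<mu> * (v \<bullet> v))"
      unfolding wd norm_add_scaleR_squared unfolding w' quad_expand[OF T] grad
      by (simp add: power2_norm_eq_inner algebra_simps)
    then show ?thesis
      using nonneg w psd[of v] slack by simp
  qed
  with \<open>0 \<le> \<mu>\<close> show "\<exists>\<mu>\<ge>0. \<forall>w. 0 \<le> quad T q \<beta> w + \<mu> * ((norm (w - d))\<^sup>2 - r)"
    by blast
qed

section \<open>Bordered matrices and inhomogeneous quadratics\<close>

lemma sum_UNIV_plus_1:
  fixes h :: "'k::finite + 1 \<Rightarrow> 'b::comm_monoid_add"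
  shows "(\<Sum>r\<in>UNIV. h r) = (\<Sum>r\<in>UNIV. h (Inl r)) + h (Inr 1)"
proof -
  have "(\<Sum>r\<in>UNIV. h r) = (\<Sum>r\<in>range Inl. h r) + (\<Sum>r\<in>range Inr. h r)"
    by (subst UNIV_sum, subst sum.union_disjoint) auto
  then show ?thesis
    by (simp add: sum.reindex UNIV_1)
qed

definition join_vec :: "real^'k \<Rightarrow> real \<Rightarrow> real^('k + 1)" where
  "join_vec w t = (\<chi> r. case r of Inl r' \<Rightarrow> w $ r' | Inr _ \<Rightarrow> t)"

lemma join_vec_exhaust:
  obtains w t where "v = join_vec w t"
proof
  show "v = join_vec (\<chi> r. v $ Inl r) (v $ Inr 1)"
    by (auto simp: join_vec_def vec_eq_iff split: sum.split)
qed

lemma bordered_quadratic_form: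
  "join_vec w t \<bullet> (bordered M v s *v join_vec w t) = w \<bullet> (M *v w) + 2 * (v \<bullet> w) * t + s * t\<^sup>2"
proof -
  have "bordered M v s *v join_vec w t = join_vec (M *v w + t *\<^sub>R v) (v \<bullet> w + s * t)"
    by (auto simp: vec_eq_iff join_vec_def bordered_def matrix_vector_mult_def sum_UNIV_plus_1
        inner_vec_def split: sum.split)
  moreover have "join_vec w t \<bullet> join_vec w' t' = w \<bullet> w' + t * t'" for w' t'
    by (simp add: inner_vec_def join_vec_def sum_UNIV_plus_1)
  ultimately show ?thesis
    by (simp add: inner_add_right inner_commute[of v w] algebra_simps power2_eq_square)
qed

text \<open>Vectors with last coordinate \<open>t \<noteq> 0\<close> are multiples of those with last coordinate \<open>1\<close>, where the form
  is the inhomogeneous quadratic; those with last coordinate \<open>0\<close> are limits of them.\<close>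
lemma bordered_psd_iff:
  assumes "M \<in> sym_mat"
  shows "bordered M v s \<in> psd_cone \<longleftrightarrow> (\<forall>w. 0 \<le> quad ((*v) M) v s w)"
proof
  assume "bordered M v s \<in> psd_cone"
  then have "0 \<le> join_vec w 1 \<bullet> (bordered M v s *v join_vec w 1)" for w
    by (simp add: psd_cone_def)
  then show "\<forall>w. 0 \<le> quad ((*v) M) v s w"
    by (simp add: bordered_quadratic_form quad_def)
next
  assume nonneg: "\<forall>w. 0 \<le> quad ((*v) M) v s w"
  have pos: "0 \<le> w \<bullet> (M *v w) + 2 * (v \<bullet> w) * t + s * t\<^sup>2" if "t \<noteq> 0" for w t
  proof -
    have "0 \<le> t\<^sup>2 * quad ((*v) M) v s ((1 / t) *\<^sub>R w)"
      using nonneg by simp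
    also have "\<dots> = w \<bullet> (M *v w) + 2 * (v \<bullet> w) * t + s * t\<^sup>2"
      using that by (simp add: quad_def matrix_vector_mult_scaleR field_simps power2_eq_square)
    finally show ?thesis .
  qed
  have "0 \<le> w \<bullet> (M *v w) + 2 * (v \<bullet> w) * t + s * t\<^sup>2" for w t
  proof (cases "t = 0")
    case True
    have "\<forall>\<^sub>F t in at_right 0. 0 \<le> w \<bullet> (M *v w) + 2 * (v \<bullet> w) * t + s * t\<^sup>2"
      using eventually_at_right_less[of 0] by (rule eventually_mono) (simp add: pos)
    from nonneg_at_0_if_eventually_nonneg[OF this] True show ?thesis
      by simp
  qed (rule pos)
  then have "0 \<le> x \<bullet> (bordered M v s *v x)" for x
    by (cases x rule: join_vec_exhaust) (simp add: bordered_quadratic_form)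
  then show "bordered M v s \<in> psd_cone"
    using bordered_sym_mat[OF assms] by (simp add: psd_cone_def)
qed

lemma sym_mat_inner:
  assumes "M \<in> sym_mat"
  shows "x \<bullet> (M *v y) = (M *v x) \<bullet> y"
proof -
  have "x \<bullet> (M *v y) = (x v* M) \<bullet> y"
    by (simp add: dot_lmul_matrix)
  also have "x v* M = M *v x"
    using assms vector_transpose_matrix[of x M] by (simp add: sym_mat_def)
  finally show ?thesis .
qed

text \<open>The bordered matrix is that of the Lagrangian, with the constraint \<open>(norm (w - d))\<^sup>2 - r\<close>
  expanded in \<open>w\<close>.\<close>
lemma ball_constraint_iff_bordered_psd:
  assumes P: "P \<in> sym_mat" and "r > 0"
  shows "(\<forall>w\<in>{w. (norm (w - d))\<^sup>2 \<le> r}. w \<bullet> (P *v w) + 2 * (q \<bullet> w) + \<beta> \<ge> 0) \<longleftrightarrow>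
    (\<exists>\<mu>\<ge>0. bordered (\<mu> *\<^sub>R mat 1 + P) (q - \<mu> *\<^sub>R d) (\<mu> * ((norm d)\<^sup>2 - r) + \<beta>) \<in> psd_cone)"
proof -
  have sym: "\<mu> *\<^sub>R mat 1 + P \<in> sym_mat" for \<mu> :: real
    using P by (auto simp: sym_mat_def transpose_def vec_eq_iff mat_def)
  have lagrangian: "quad ((*v) (\<mu> *\<^sub>R mat 1 + P)) (q - \<mu> *\<^sub>R d) (\<mu> * ((norm d)\<^sup>2 - r) + \<beta>) w =
      quad ((*v) P) q \<beta> w + \<mu> * ((norm (w - d))\<^sup>2 - r)" for \<mu> w
    by (simp add: quad_def matrix_vector_mult_add_rdistrib scaleR_matrix_vector_assoc[symmetric]
        power2_norm_eq_inner inner_diff_left inner_diff_right inner_add_right inner_commute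
        algebra_simps)
  show ?thesis
    unfolding bordered_psd_iff[OF sym] lagrangian
    using S_lemma_ball[OF matrix_vector_mul_linear sym_mat_inner[OF P] \<open>r > 0\<close>, of d q \<beta>]
    by (simp add: quad_def)
qed

section \<open>Equality of the optimal values\<close>

lemma sym_mat_iff: "M \<in> sym_mat \<longleftrightarrow> (\<forall>k l. M $ k $ l = M $ l $ k)"
  unfolding sym_mat_def transpose_def vec_eq_iff mem_Collect_eq vec_lambda_beta by metis

lemma P_qdr_sym_mat:
  assumes "z \<in> X_hat"
  shows "P_qdr \<rho> c i z \<in> sym_mat"
proof -
  obtain x y0 U \<Theta> where z: "z = (x, y0, U, \<Theta>)"
    by (cases z)
  have sym0: "\<forall>p. \<Theta> $ p \<in> sym_mat"
    using assms by (simp add: z X_hat_def)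
  then have sym: "\<Theta> $ p $ k $ l = \<Theta> $ p $ l $ k" for p k l
    unfolding sym_mat_iff by blast
  show ?thesis
    unfolding sym_mat_iff
  proof (intro allI)
    fix k l
    show "P_qdr \<rho> c i z $ k $ l = P_qdr \<rho> c i z $ l $ k"
      by (simp only: z P_qdr.simps vector_uminus_component vector_scaleR_component
          sum_component sym[of _ k l])
  qed
qed

lemma translate_psd_cone_iff: "\<Psi> \<in> (\<lambda>M. B + M) ` psd_cone \<longleftrightarrow> \<Psi> - B \<in> psd_cone"
proof
  assume "\<Psi> - B \<in> psd_cone"
  then show "\<Psi> \<in> (\<lambda>M. B + M) ` psd_cone"
    by (rule rev_image_eqI) simp
qed auto

lemma bordered_diff:
  "bordered M v s - bordered M' v' s' = bordered (M - M') (v - v') (s - s')"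
  by (auto simp: vec_eq_iff bordered_def split: sum.split)

lemma K_comp_minus_B_mat:
  "K_comp dd r \<rho> a0 a c (x, y0, U, \<Theta>, lam) $ i - B_mat b0 b i =
    bordered ((lam $ i) *\<^sub>R mat 1 + P_qdr \<rho> c i (x, y0, U, \<Theta>))
      (q_qdr \<rho> a b c i (x, y0, U, \<Theta>) - (lam $ i) *\<^sub>R dd)
      ((lam $ i) * ((norm dd)\<^sup>2 - r) + beta_qdr \<rho> a0 b0 c i (x, y0, U, \<Theta>))"
  by (simp add: B_mat_def bordered_diff algebra_simps)

text \<open>The indicators of the composite problem that are absent from the objective of (P-QDR) require
  that \<open>lam\<close> certifies the robust constraints.\<close>
definition multipliers :: "real^'k \<Rightarrow> real \<Rightarrow> real \<Rightarrow> ('m \<Rightarrow> real^'d) \<Rightarrow> ('m \<Rightarrow> 'k \<Rightarrow> real^'d) \<Rightarrow>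
    ('m \<Rightarrow> real) \<Rightarrow> ('m \<Rightarrow> real^'k) \<Rightarrow> ('m \<Rightarrow> real^'q) \<Rightarrow>
    ('d::finite, 'q::finite, 'k::finite) qdr_var \<Rightarrow> (real^'m::finite) set" where
  "multipliers dd r \<rho> a0 a b0 b c z = {lam. \<forall>i. 0 \<le> lam $ i \<and>
     bordered ((lam $ i) *\<^sub>R mat 1 + P_qdr \<rho> c i z) (q_qdr \<rho> a b c i z - (lam $ i) *\<^sub>R dd)
       ((lam $ i) * ((norm dd)\<^sup>2 - r) + beta_qdr \<rho> a0 b0 c i z) \<in> psd_cone}"

lemma qdr_feasible_iff_multipliers:
  assumes "r > 0"
  shows "z \<in> qdr_feasible {w. (norm (w - dd))\<^sup>2 \<le> r} \<rho> a0 a b0 b c \<longleftrightarrow>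
    z \<in> X_hat \<and> multipliers dd r \<rho> a0 a b0 b c z \<noteq> {}"
proof (cases "z \<in> X_hat")
  case True
  let ?R = "\<lambda>i l. 0 \<le> l \<and> bordered (l *\<^sub>R mat 1 + P_qdr \<rho> c i z) (q_qdr \<rho> a b c i z - l *\<^sub>R dd)
    (l * ((norm dd)\<^sup>2 - r) + beta_qdr \<rho> a0 b0 c i z) \<in> psd_cone"
  have "z \<in> qdr_feasible {w. (norm (w - dd))\<^sup>2 \<le> r} \<rho> a0 a b0 b c \<longleftrightarrow> (\<forall>i. \<exists>l. ?R i l)"
    unfolding qdr_feasible_def mem_Collect_eq[where a = z]
      ball_constraint_iff_bordered_psd[OF P_qdr_sym_mat[OF True] \<open>r > 0\<close>]
    using True by simp
  also have "\<dots> \<longleftrightarrow> (\<exists>lam. \<forall>i. ?R i (lam $ i))"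
  proof
    assume "\<forall>i. \<exists>l. ?R i l"
    then obtain L where "\<forall>i. ?R i (L i)"
      by metis
    then show "\<exists>lam. \<forall>i. ?R i (lam $ i)"
      by (intro exI[of _ "vec_lambda L"]) simp
  qed blast
  finally show ?thesis
    using True unfolding multipliers_def by blast
qed (simp add: qdr_feasible_def)

lemma sum_iota:
  "(\<Sum>i\<in>UNIV. iota (A i) (h i)) = (if \<forall>i::'m::finite. h i \<in> A i then 0 else \<infinity>)"
proof (cases "\<forall>i. h i \<in> A i")
  case False
  then obtain i where "iota (A i) (h i) = \<infinity>"
    by (auto simp: iota_def)
  then have "(\<Sum>i\<in>UNIV. iota (A i) (h i)) = \<infinity>"
    by (auto simp: sum_Pinfty)
  with False show ?thesis
    by simp
qed (simp add: iota_def)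

lemma composite_objective:
  "F_comp f (x, y0, U, \<Theta>, lam) + E_comp \<C> (x, y0, U, \<Theta>, lam) + H_comp \<D> (x, y0, U, \<Theta>, lam)
      + G_comp b0 b (K_comp dd r \<rho> a0 a c (x, y0, U, \<Theta>, lam)) =
    (if lam \<in> multipliers dd r \<rho> a0 a b0 b c (x, y0, U, \<Theta>)
     then qdr_objective f \<C> \<D> (x, y0, U, \<Theta>) else \<infinity>)"
proof -
  have "lam \<in> multipliers dd r \<rho> a0 a b0 b c (x, y0, U, \<Theta>) \<longleftrightarrow> (\<forall>i. lam $ i \<in> {0..}) \<and>
      (\<forall>i. K_comp dd r \<rho> a0 a c (x, y0, U, \<Theta>, lam) $ i \<in> (\<lambda>M. B_mat b0 b i + M) ` psd_cone)"
    unfolding translate_psd_cone_iff K_comp_minus_B_mat multipliers_def by blast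
  then show ?thesis
    unfolding G_comp_def F_comp.simps E_comp.simps H_comp.simps qdr_objective.simps sum_iota
    by (simp add: iota_def del: K_comp.simps)
qed

theorem theorem3p2:
  fixes f :: "real^'d \<Rightarrow> ereal"
    and \<C> :: "(real^'d) set"
    and s :: nat and g :: "nat \<Rightarrow> real^'d \<Rightarrow> real"
    and a0 :: "'m::finite \<Rightarrow> real^'d" and a :: "'m \<Rightarrow> 'k::finite \<Rightarrow> real^'d"
    and b0 :: "'m \<Rightarrow> real" and b :: "'m \<Rightarrow> real^'k"
    and c :: "'m \<Rightarrow> real^'q"
    and \<rho> r :: real and dd :: "real^'k"
  assumes "proper_fun f" and "convex_fun f" and "lsc_fun f"
    and "closed \<C>" and "convex \<C>"
    and "\<And>j. j \<in> {1..s} \<Longrightarrow> sos_convex (g j)"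
    and "\<rho> \<in> {0..1}" and "r > 0"
  shows "qdr_value f \<C> (level_set s g) {w. (norm (w - dd))\<^sup>2 \<le> r} \<rho> a0 a b0 b c =
    (INF z \<in> X_tilde. F_comp f z + E_comp \<C> z + H_comp (level_set s g) z
       + G_comp b0 b (K_comp dd r \<rho> a0 a c z))"
proof -
  note feasible = qdr_feasible_iff_multipliers[OF \<open>r > 0\<close>]
  show ?thesis
    unfolding qdr_value_def
  proof (rule antisym)
    show "(INF z\<in>qdr_feasible {w. (norm (w - dd))\<^sup>2 \<le> r} \<rho> a0 a b0 b c.
          qdr_objective f \<C> (level_set s g) z)
        \<le> (INF z \<in> X_tilde. F_comp f z + E_comp \<C> z + H_comp (level_set s g) z
          + G_comp b0 b (K_comp dd r \<rho> a0 a c z))"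
    proof (rule INF_greatest)
      fix z :: "('d, 'q, 'k, 'm) comp_var"
      assume z: "z \<in> X_tilde"
      obtain x y0 U \<Theta> lam where z_eq: "z = (x, y0, U, \<Theta>, lam)"
        by (cases z)
      have hat: "(x, y0, U, \<Theta>) \<in> X_hat"
        using z by (simp add: z_eq X_tilde_def X_hat_def)
      show "(INF z\<in>qdr_feasible {w. (norm (w - dd))\<^sup>2 \<le> r} \<rho> a0 a b0 b c.
            qdr_objective f \<C> (level_set s g) z)
          \<le> F_comp f z + E_comp \<C> z + H_comp (level_set s g) z
            + G_comp b0 b (K_comp dd r \<rho> a0 a c z)"
      proof (cases "lam \<in> multipliers dd r \<rho> a0 a b0 b c (x, y0, U, \<Theta>)")
        case True
        with hat have "(x, y0, U, \<Theta>) \<in> qdr_feasible {w. (norm (w - dd))\<^sup>2 \<le> r} \<rho> a0 a b0 b c"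
          unfolding feasible by blast
        with True show ?thesis
          by (simp only: z_eq composite_objective if_True INF_lower)
      next
        case False
        then show ?thesis
          by (simp only: z_eq composite_objective if_False ereal_less_eq)
      qed
    qed
  next
    show "(INF z \<in> X_tilde. F_comp f z + E_comp \<C> z + H_comp (level_set s g) z
          + G_comp b0 b (K_comp dd r \<rho> a0 a c z))
        \<le> (INF z\<in>qdr_feasible {w. (norm (w - dd))\<^sup>2 \<le> r} \<rho> a0 a b0 b c.
          qdr_objective f \<C> (level_set s g) z)"
    proof (rule INF_greatest)
      fix z :: "('d, 'q, 'k) qdr_var"
      assume "z \<in> qdr_feasible {w. (norm (w - dd))\<^sup>2 \<le> r} \<rho> a0 a b0 b c"
      then obtain lam where X: "z \<in> X_hat" and lam: "lam \<in> multipliers dd r \<rho> a0 a b0 b c z"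
        unfolding feasible by blast
      obtain x y0 U \<Theta> where z_eq: "z = (x, y0, U, \<Theta>)"
        by (cases z)
      have tilde: "(x, y0, U, \<Theta>, lam) \<in> X_tilde"
        using X by (simp add: z_eq X_tilde_def X_hat_def)
      show "(INF z \<in> X_tilde. F_comp f z + E_comp \<C> z + H_comp (level_set s g) z
          + G_comp b0 b (K_comp dd r \<rho> a0 a c z)) \<le> qdr_objective f \<C> (level_set s g) z"
        using lam by (intro INF_lower2[OF tilde]) (simp only: z_eq composite_objective if_True order_refl)
    qed
  qed
qed

end
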